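(* Let $k\ge 2$ be a constant. Every deterministic $\mathsf{Online}$-$\mathsf{LOCAL}$ algorithm that properly colors every $n$-node $k$-partite graph using at most $2k-2$ colors has locality $\Omega(n)$.
   Context: A graph is $k$-partite if it admits a proper coloring with $k$ colors. For a graph $G=(V,E)$, $U\subseteq V$ and an integer $T\ge 0$, $\mathcal{B}(U,T)$ denotes the set of nodes at distance at most $T$ from some node of $U$, and $G[U]$ denotes the induced subgraph. The $\mathsf{Online}$-$\mathsf{LOCAL}$ model: an algorithm with locality $T=T(n)$ is deterministic and knows $n$. The adversary chooses an $n$-node input graph $G=(V,E)$ from the input family, assigns distinct identifiers from $\{1,\dots,\mathrm{poly}(n)\}$ to its nodes, and chooses an ordering $\sigma=(v_1,\dots,v_n)$ of $V$. For $i=1,\dots,n$, when $v_i$ is presented, the algorithm must irrevocably assign an output (here a color) to $v_i$ as a function of the sequence $(v_1,\dots,v_i)$ and the induced subgraph $G_i=G\big[\bigcup_{j\le i}\mathcal{B}(v_j,T)\big]$ (with identifiers); thus the algorithm has global memory of everything seen so far. The algorithm solves a coloring problem on an input family if for every choice of the adversary the final coloring is proper and uses only the allowed colors. The locality of a problem is the minimum locality of an algorithm solving it. *)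

theory Defs
  imports Main "HOL-Library.Landau_Symbols"
begin

definition is_graph :: "nat \<Rightarrow> (nat \<Rightarrow> nat \<Rightarrow> bool) \<Rightarrow> bool" where
  "is_graph n E \<longleftrightarrow> (\<forall>x y. E x y \<longrightarrow> x < n \<and> y < n \<and> x \<noteq> y \<and> E y x)"

definition k_partite :: "nat \<Rightarrow> nat \<Rightarrow> (nat \<Rightarrow> nat \<Rightarrow> bool) \<Rightarrow> bool" where
  "k_partite k n E \<longleftrightarrow> (\<exists>c. (\<forall>v<n. c v < k) \<and> (\<forall>x y. E x y \<longrightarrow> c x \<noteq> c y))"

definition nbhd :: "(nat \<Rightarrow> nat \<Rightarrow> bool) \<Rightarrow> nat set \<Rightarrow> nat \<Rightarrow> nat set" where
  "nbhd E U T = {v. \<exists>u\<in>U. \<exists>m\<le>T. (u, v) \<in> {(x, y). E x y} ^^ m}"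

text \<open>What the algorithm sees when the i-th node is presented: the identifiers of
  the presented nodes (in order) and the induced subgraph G_i, expressed via identifiers.\<close>
type_synonym view = "nat list \<times> nat set \<times> (nat \<times> nat) set"

definition view_at :: "(nat \<Rightarrow> nat \<Rightarrow> bool) \<Rightarrow> (nat \<Rightarrow> nat) \<Rightarrow> nat list \<Rightarrow> nat \<Rightarrow> nat \<Rightarrow> view" where
  "view_at E ident \<sigma> T i =
     (let W = nbhd E (set (take i \<sigma>)) T in
       (map ident (take i \<sigma>), ident ` W,
        {(ident x, ident y) | x y. x \<in> W \<and> y \<in> W \<and> E x y}))"

text \<open>A deterministic Online-LOCAL algorithm: A n (view) is the color of the newest node;
  T n is its locality. It solves q-coloring on family P (identifiers from {1..n^C}) if
  for every adversary choice the final coloring is proper and uses colors in {0..<q}.\<close>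
definition solves_coloring ::
  "nat \<Rightarrow> (nat \<Rightarrow> (nat \<Rightarrow> nat \<Rightarrow> bool) \<Rightarrow> bool) \<Rightarrow> nat \<Rightarrow> (nat \<Rightarrow> view \<Rightarrow> nat) \<Rightarrow> (nat \<Rightarrow> nat) \<Rightarrow> bool" where
  "solves_coloring C P q A T \<longleftrightarrow>
     (\<forall>n E ident \<sigma>.
        is_graph n E \<and> P n E \<and>
        inj_on ident {0..<n} \<and> ident ` {0..<n} \<subseteq> {1..n ^ C} \<and>
        distinct \<sigma> \<and> set \<sigma> = {0..<n} \<longrightarrow>
        (let col = (\<lambda>j. A n (view_at E ident \<sigma> (T n) (Suc j))) in
          (\<forall>j<n. col j < q) \<and>
          (\<forall>j<n. \<forall>j'<n. E (\<sigma> ! j) (\<sigma> ! j') \<longrightarrow> col j \<noteq> col j')))"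

end

theory Submission
  imports Defs
begin

text \<open>
  In a coloring of the tensor product of two \<open>k\<close>-cliques with fewer than \<open>2k - 1\<close> colors, either
  some row or some column is rainbow, but not both. If copies of this product are placed in a
  chain, with consecutive copies joined by the same rule, then all of them are of the same type.
  The adversary presents the two ends of a long chain first. As long as the locality does not
  bridge the chain, the algorithm cannot tell the chain from the one whose second half is
  transposed, although transposing one end exchanges its type.
\<close>

section \<open>Colorings of products of cliques with few colors\<close>

definition rainbow_row :: "nat \<Rightarrow> (nat \<Rightarrow> nat \<Rightarrow> nat) \<Rightarrow> bool" where
  "rainbow_row k F \<longleftrightarrow> (\<exists>a<k. inj_on (F a) {..<k})"

abbreviation rainbow_col :: "nat \<Rightarrow> (nat \<Rightarrow> nat \<Rightarrow> nat) \<Rightarrow> bool" where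
  "rainbow_col k F \<equiv> rainbow_row k (\<lambda>a b. F b a)"

text \<open>Properness across the edges joining two copies of the product; taking
  \<open>F = G\<close> gives properness within one copy.\<close>

definition tensor_proper :: "nat \<Rightarrow> (nat \<Rightarrow> nat \<Rightarrow> nat) \<Rightarrow> (nat \<Rightarrow> nat \<Rightarrow> nat) \<Rightarrow> bool" where
  "tensor_proper k F G \<longleftrightarrow>
     (\<forall>a<k. \<forall>b<k. \<forall>a'<k. \<forall>b'<k. a \<noteq> a' \<and> b \<noteq> b' \<longrightarrow> F a b \<noteq> G a' b')"

lemma tensor_properD:
  assumes "tensor_proper k F G" "a < k" "b < k" "a' < k" "b' < k" "F a b = G a' b'"
  shows "a = a' \<or> b = b'"
  using assms unfolding tensor_proper_def by blast

text \<open>A column cell outside the row is adjacent to every row cell except the one in its own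
  column, and the column is rainbow. So row and column together show \<open>k + (k - 1)\<close>
  colors.\<close>

lemma rainbow_row_and_col_colors:
  assumes "tensor_proper k F F" "\<And>a b. a < k \<Longrightarrow> b < k \<Longrightarrow> F a b < q"
    and "rainbow_row k F" "rainbow_col k F"
  shows "2 * k - 1 \<le> q"
proof -
  obtain r c where r: "r < k" "inj_on (F r) {..<k}" and c: "c < k" "inj_on (\<lambda>a. F a c) {..<k}"
    using assms(3,4) unfolding rainbow_row_def by blast
  let ?row = "F r ` {..<k}" and ?col = "(\<lambda>a. F a c) ` ({..<k} - {r})"
  have disj: "?row \<inter> ?col = {}"
  proof -
    have False if h: "b < k" "a < k" "a \<noteq> r" "F r b = F a c" for a b
    proof -
      have "b = c" using tensor_properD[OF assms(1) r(1) h(1,2) c(1) h(4)] h(3) by auto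
      then show False using h r(1) inj_onD[OF c(2), of r a] by simp
    qed
    then show ?thesis by blast
  qed
  have "inj_on (\<lambda>a. F a c) ({..<k} - {r})" using c(2) by (rule inj_on_subset) auto
  then have "card ?col = k - 1" using r(1) by (simp add: card_image)
  moreover have "card ?row = k" using r(2) by (simp add: card_image)
  ultimately have "card (?row \<union> ?col) = k + (k - 1)" using disj by (simp add: card_Un_disjoint)
  moreover have "?row \<union> ?col \<subseteq> {..<q}" using assms(2) r(1) c(1) by auto
  ultimately show ?thesis using card_mono[of "{..<q}" "?row \<union> ?col"] by simp
qed

text \<open>Two occurrences of a repeated color are recorded in each row, so that one of them always
  avoids a prescribed column.\<close>

lemma not_rainbow_row_repeated:
  assumes "\<not> rainbow_row k F"
  obtains c l r where "\<And>a. a < k \<Longrightarrow> l a < k \<and> r a < k \<and> l a \<noteq> r a \<and> F a (l a) = c a \<and> F a (r a) = c a"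
proof -
  have "\<forall>a. \<exists>b b'. a < k \<longrightarrow> b < k \<and> b' < k \<and> b \<noteq> b' \<and> F a b = F a b'"
    using assms unfolding rainbow_row_def inj_on_def by blast
  then obtain l r where "\<forall>a. a < k \<longrightarrow> l a < k \<and> r a < k \<and> l a \<noteq> r a \<and> F a (l a) = F a (r a)"
    by metis
  then show ?thesis using that[of l r "\<lambda>a. F a (l a)"] by auto
qed

text \<open>A color repeated in a row occurs in no other row, and likewise for columns. This
  gives \<open>k\<close> colors owned by the rows and \<open>k\<close> further ones owned by the columns.\<close>

lemma no_rainbow_row_no_rainbow_col_colors:
  assumes "tensor_proper k F F" "tensor_proper k G G" "tensor_proper k F G"
    and "\<And>a b. a < k \<Longrightarrow> b < k \<Longrightarrow> F a b < q" "\<And>a b. a < k \<Longrightarrow> b < k \<Longrightarrow> G a b < q"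
    and "\<not> rainbow_row k F" "\<not> rainbow_col k G"
  shows "2 * k \<le> q"
proof -
  obtain c l r where c: "\<And>a. a < k \<Longrightarrow> l a < k \<and> r a < k \<and> l a \<noteq> r a \<and> F a (l a) = c a \<and> F a (r a) = c a"
    using assms(6) by (rule not_rainbow_row_repeated) blast
  obtain d u w where d: "\<And>b. b < k \<Longrightarrow> u b < k \<and> w b < k \<and> u b \<noteq> w b \<and> G (u b) b = d b \<and> G (w b) b = d b"
    using assms(7) by (rule not_rainbow_row_repeated) blast
  \<comment> \<open>If \<open>a \<noteq> a'\<close>, both \<open>l a\<close> and \<open>r a\<close>
    would have to equal \<open>l a'\<close>, yet they are distinct.\<close>
  have "inj_on c {..<k}"
  proof (rule inj_onI)
    fix a a' assume h: "a \<in> {..<k}" "a' \<in> {..<k}" "c a = c a'"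
    then show "a = a'"
      using c[of a] c[of a'] tensor_properD[OF assms(1), of a "l a" a' "l a'"]
        tensor_properD[OF assms(1), of a "r a" a' "l a'"] by (metis lessThan_iff)
  qed
  moreover have "inj_on d {..<k}"
  proof (rule inj_onI)
    fix b b' assume h: "b \<in> {..<k}" "b' \<in> {..<k}" "d b = d b'"
    then show "b = b'"
      using d[of b] d[of b'] tensor_properD[OF assms(2), of "u b" b "u b'" b']
        tensor_properD[OF assms(2), of "w b" b "u b'" b'] by (metis lessThan_iff)
  qed
  moreover have "c ` {..<k} \<inter> d ` {..<k} = {}"
  proof -
    have False if h: "a < k" "b < k" "c a = d b" for a b
    proof -
      \<comment> \<open>An occurrence of \<open>c a\<close> off column \<open>b\<close> and one of
        \<open>d b\<close> off row \<open>a\<close> lie in cells that differ in both coordinates, so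
        properness separates their colors.\<close>
      obtain b' where b': "b' < k" "b' \<noteq> b" "F a b' = c a" using c[OF h(1)] by metis
      obtain a' where a': "a' < k" "a' \<noteq> a" "G a' b = d b" using d[OF h(2)] by metis
      show False using tensor_properD[OF assms(3) h(1) b'(1) a'(1) h(2)] a' b' h(3) by auto
    qed
    then show ?thesis by blast
  qed
  ultimately have "card (c ` {..<k} \<union> d ` {..<k}) = k + k"
    by (simp add: card_Un_disjoint card_image)
  moreover have "c ` {..<k} \<union> d ` {..<k} \<subseteq> {..<q}"
    using c d assms(4,5) by (auto; metis)
  ultimately show ?thesis using card_mono[of "{..<q}" "c ` {..<k} \<union> d ` {..<k}"] by simp
qed

lemma rainbow_col_iff:
  assumes "tensor_proper k F F" "\<And>a b. a < k \<Longrightarrow> b < k \<Longrightarrow> F a b < q" "q < 2 * k - 1"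
  shows "rainbow_col k F \<longleftrightarrow> \<not> rainbow_row k F"
  using rainbow_row_and_col_colors[of k F q] no_rainbow_row_no_rainbow_col_colors[of k F F q] assms
  by fastforce

text \<open>The \<open>2 * k\<close> bound, applied to consecutive copies in both orders, shows that
  a copy without a rainbow row forces a rainbow column, hence no rainbow row, in its
  neighbors.\<close>

lemma rainbow_row_chain:
  assumes proper: "\<And>g h. g < m \<Longrightarrow> h < m \<Longrightarrow> g \<le> Suc h \<Longrightarrow> h \<le> Suc g \<Longrightarrow> tensor_proper k (f g) (f h)"
    and bound: "\<And>g a b. g < m \<Longrightarrow> a < k \<Longrightarrow> b < k \<Longrightarrow> f g a b < q"
    and q: "q < 2 * k - 1" and "g < m"
  shows "rainbow_row k (f g) \<longleftrightarrow> rainbow_row k (f 0)"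
  using \<open>g < m\<close>
proof (induction g)
  case (Suc g)
  have compat: "rainbow_row k (f i) \<or> rainbow_col k (f j)"
    if "i < m" "j < m" "i \<le> Suc j" "j \<le> Suc i" for i j
    using no_rainbow_row_no_rainbow_col_colors[of k "f i" "f j" q] that proper bound q by fastforce
  have iff: "rainbow_col k (f i) \<longleftrightarrow> \<not> rainbow_row k (f i)" if "i < m" for i
    using rainbow_col_iff[of k "f i" q] that proper bound q by simp
  show ?case
    using Suc compat[of g "Suc g"] compat[of "Suc g" g] iff[of g] iff[of "Suc g"] by auto
qed simp

section \<open>The chain of gadgets\<close>

definition gadget :: "nat \<Rightarrow> nat \<Rightarrow> nat" where "gadget k x = x div k div k"

text \<open>Gadget \<open>g\<close> occupies a block of \<open>k * k\<close> consecutive numbers,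
  with the two coordinates as base-\<open>k\<close> digits.\<close>

definition node :: "nat \<Rightarrow> nat \<Rightarrow> nat \<Rightarrow> nat \<Rightarrow> nat" where "node k g a b = (g * k + a) * k + b"

text \<open>Transposition acts on coordinates and not on node numbers, so both chains live on the
  same nodes and can be compared under fixed identifiers.\<close>

definition row :: "nat \<Rightarrow> nat \<Rightarrow> nat \<Rightarrow> nat" where
  "row k s x = (if gadget k x \<le> s then x div k mod k else x mod k)"

definition col :: "nat \<Rightarrow> nat \<Rightarrow> nat \<Rightarrow> nat" where
  "col k s x = (if gadget k x \<le> s then x mod k else x div k mod k)"

text \<open>The adversary decides between \<open>s = m\<close> (no gadget is transposed) and \<open>s\<close> equal to the locality.\<close>

definition chain :: "nat \<Rightarrow> nat \<Rightarrow> nat \<Rightarrow> nat \<Rightarrow> nat \<Rightarrow> bool" where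
  "chain k m s x y \<longleftrightarrow> gadget k x < m \<and> gadget k y < m \<and>
     gadget k x \<le> Suc (gadget k y) \<and> gadget k y \<le> Suc (gadget k x) \<and>
     row k s x \<noteq> row k s y \<and> col k s x \<noteq> col k s y"

lemma gadget_less_iff: "0 < k \<Longrightarrow> gadget k x < m \<longleftrightarrow> x < m * k * k"
  by (simp add: gadget_def div_less_iff_less_mult)

lemma
  assumes "a < k" "b < k"
  shows gadget_node: "gadget k (node k g a b) = g"
    and row_node: "row k s (node k g a b) = (if g \<le> s then a else b)"
    and col_node: "col k s (node k g a b) = (if g \<le> s then b else a)"
  using assms by (auto simp: gadget_def node_def row_def col_def)

text \<open>Nodes from \<open>m * k * k\<close> on are isolated padding, which makes the
  construction available for every large \<open>n\<close>.\<close>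

lemma is_graph_chain:
  assumes "0 < k" "m * k * k \<le> n"
  shows "is_graph n (chain k m s)"
  using assms by (auto simp: is_graph_def chain_def gadget_less_iff)

text \<open>Adjacent nodes differ in \<open>row k s\<close>, so this coordinate is itself a proper
  coloring.\<close>

lemma k_partite_chain:
  assumes "0 < k"
  shows "k_partite k n (chain k m s)"
  unfolding k_partite_def using assms by (intro exI[of _ "row k s"]) (auto simp: row_def chain_def)

text \<open>Reads the coloring of a gadget in the coordinates \<open>row k s\<close> and
  \<open>col k s\<close>, undoing the transposition beyond \<open>s\<close>; consecutive gadgets
  then satisfy \<open>tensor_proper\<close>.\<close>

definition straighten :: "nat \<Rightarrow> nat \<Rightarrow> (nat \<Rightarrow> nat) \<Rightarrow> nat \<Rightarrow> nat \<Rightarrow> nat \<Rightarrow> nat" where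
  "straighten k s c g a b = (if g \<le> s then c (node k g a b) else c (node k g b a))"

lemma rainbow_row_coloring:
  assumes k: "0 < k" "m * k * k \<le> n"
    and bound: "\<And>v. v < n \<Longrightarrow> c v < q"
    and proper: "\<And>x y. chain k m s x y \<Longrightarrow> c x \<noteq> c y"
    and q: "q < 2 * k - 1" and g: "g < m"
  shows "rainbow_row k (straighten k s c g) \<longleftrightarrow> rainbow_row k (straighten k s c 0)"
    and "rainbow_col k (straighten k s c g) \<longleftrightarrow> \<not> rainbow_row k (straighten k s c g)"
proof -
  have P: "tensor_proper k (straighten k s c g) (straighten k s c h)"
    if "g < m" "h < m" "g \<le> Suc h" "h \<le> Suc g" for g h
    unfolding tensor_proper_def straighten_def
    using that by (auto intro!: proper simp: chain_def gadget_node row_node col_node)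
  have B: "straighten k s c g a b < q" if "g < m" "a < k" "b < k" for g a b
  proof -
    have "node k g a b < n" "node k g b a < n"
      using that k gadget_node gadget_less_iff[of k _ m] by (metis order_less_le_trans)+
    then show ?thesis using bound by (simp add: straighten_def)
  qed
  show "rainbow_row k (straighten k s c g) \<longleftrightarrow> rainbow_row k (straighten k s c 0)"
    by (rule rainbow_row_chain[of m k "straighten k s c" q]) (use P B q g in auto)
  show "rainbow_col k (straighten k s c g) \<longleftrightarrow> \<not> rainbow_row k (straighten k s c g)"
    by (rule rainbow_col_iff[of k _ q]) (use P B q g in auto)
qed

section \<open>Indistinguishability near the ends\<close>

lemma chain_twist:
  assumes "chain k m s x y" "{s, s'} = {t, m}" "gadget k x \<le> t \<longleftrightarrow> gadget k y \<le> t"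
  shows "chain k m s' x y"
  \<comment> \<open>On one side of the cut the coordinates of both endpoints are kept or both are
    exchanged, and an exchange preserves differing in both coordinates.\<close>
  using assms by (cases "gadget k x \<le> t") (auto simp: chain_def row_def col_def doubleton_eq_iff)

text \<open>Each step moves by at most one gadget, so a walk of length at most \<open>t\<close> from
  either end never uses an edge between gadgets \<open>t\<close> and \<open>t + 1\<close>, the only
  place where the two chains differ.\<close>

lemma chain_relpow_twist:
  assumes "(u, v) \<in> {(x, y). chain k m s x y} ^^ j" "j \<le> t" "2 * t + 3 \<le> m"
    and "{s, s'} = {t, m}" "gadget k u = 0 \<or> gadget k u = m - 1"
  shows "(u, v) \<in> {(x, y). chain k m s' x y} ^^ j \<and> (gadget k v \<le> j \<or> m - 1 \<le> gadget k v + j)"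
  using assms(1,2)
proof (induction j arbitrary: v)
  case 0
  then show ?case using assms(5) by auto
next
  case (Suc j)
  then obtain y where y: "(u, y) \<in> {(x, y). chain k m s x y} ^^ j" "chain k m s y v" by auto
  with Suc have IH: "(u, y) \<in> {(x, y). chain k m s' x y} ^^ j"
    "gadget k y \<le> j \<or> m - 1 \<le> gadget k y + j" by auto
  have v: "gadget k v \<le> Suc j \<or> m - 1 \<le> gadget k v + Suc j"
    using IH(2) y(2) by (auto simp: chain_def)
  have "gadget k y \<le> t \<longleftrightarrow> gadget k v \<le> t"
    using IH(2) y(2) Suc.prems(2) assms(3) by (auto simp: chain_def)
  with y(2) assms(4) have "chain k m s' y v" by (rule chain_twist)
  with IH(1) v show ?case by auto
qed

lemma nbhd_chain_subset:
  assumes "2 * t + 3 \<le> m" "{s, s'} = {t, m}" "\<And>u. u \<in> U \<Longrightarrow> gadget k u = 0 \<or> gadget k u = m - 1"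
  shows "nbhd (chain k m s) U t \<subseteq>
    nbhd (chain k m s') U t \<inter> {v. gadget k v \<le> t \<or> m - 1 \<le> gadget k v + t}"
proof
  fix v assume "v \<in> nbhd (chain k m s) U t"
  then obtain u j where u: "u \<in> U" "j \<le> t" "(u, v) \<in> {(x, y). chain k m s x y} ^^ j"
    unfolding nbhd_def by blast
  from chain_relpow_twist[OF u(3,2) assms(1,2) assms(3)[OF u(1)]] u(1,2)
  show "v \<in> nbhd (chain k m s') U t \<inter> {v. gadget k v \<le> t \<or> m - 1 \<le> gadget k v + t}"
    unfolding nbhd_def by auto
qed

lemma view_at_chain_twist:
  assumes "2 * t + 3 \<le> m" "\<And>u. u \<in> set (take i \<sigma>) \<Longrightarrow> gadget k u = 0 \<or> gadget k u = m - 1"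
  shows "view_at (chain k m t) ident \<sigma> t i = view_at (chain k m m) ident \<sigma> t i"
proof -
  let ?U = "set (take i \<sigma>)"
  have W: "nbhd (chain k m t) ?U t = nbhd (chain k m m) ?U t"
    using nbhd_chain_subset[OF assms(1) _ assms(2), of t m]
      nbhd_chain_subset[OF assms(1) _ assms(2), of m t] by blast
  have near: "gadget k v \<le> t \<or> m - 1 \<le> gadget k v + t" if "v \<in> nbhd (chain k m m) ?U t" for v
    using nbhd_chain_subset[OF assms(1) _ assms(2), of m t] that by blast
  \<comment> \<open>Induced edges need not lie on short walks from the ends. Since
    \<open>2 * t + 3 \<le> m\<close>, gadget \<open>t + 1\<close> is not visible, so no visible edge
    crosses the cut.\<close>
  have "chain k m t x y \<longleftrightarrow> chain k m m x y"
    if "x \<in> nbhd (chain k m m) ?U t" "y \<in> nbhd (chain k m m) ?U t" for x y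
    using near[OF that(1)] near[OF that(2)] assms(1) by (auto simp: chain_def row_def col_def)
  then show ?thesis unfolding view_at_def Let_def W by blast
qed

section \<open>The adversary and the resulting bound\<close>

lemma locality_lower_bound:
  assumes k: "2 \<le> k" "1 \<le> C"
    and A: "solves_coloring C (k_partite k) (2 * k - 2) A T"
    and m: "0 < m" "m * k * k \<le> n"
  shows "m < 2 * T n + 3"
proof (rule ccontr)
  assume "\<not> m < 2 * T n + 3"
  then have T: "2 * T n + 3 \<le> m" by simp
  define ends where "ends v \<longleftrightarrow> gadget k v = 0 \<or> gadget k v = m - 1" for v
  define L where "L = filter ends [0..<n]"
  \<comment> \<open>All nodes of both end gadgets come first, so they are colored before any
    interior node is presented.\<close>
  define \<sigma> where "\<sigma> = L @ filter (\<lambda>v. \<not> ends v) [0..<n]"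
  have \<sigma>: "distinct \<sigma>" "set \<sigma> = {0..<n}" by (auto simp: \<sigma>_def L_def)
  have len: "length \<sigma> = n" using distinct_card[OF \<sigma>(1)] \<sigma>(2) by simp
  have "\<forall>v. \<exists>j. v < n \<longrightarrow> j < n \<and> \<sigma> ! j = v \<and> (ends v \<longrightarrow> j < length L)"
  proof
    fix v
    show "\<exists>j. v < n \<longrightarrow> j < n \<and> \<sigma> ! j = v \<and> (ends v \<longrightarrow> j < length L)"
    proof (cases "v < n \<and> ends v")
      case True
      then have "v \<in> set L" by (simp add: L_def)
      then obtain j where "j < length L" "L ! j = v" by (auto simp: in_set_conv_nth)
      then show ?thesis using len by (intro exI[of _ j]) (auto simp: \<sigma>_def nth_append)
    next
      case False
      then show ?thesis using \<sigma>(2) len by (metis atLeastLessThan_iff in_set_conv_nth le0)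
    qed
  qed
  then obtain pos where pos: "\<And>v. v < n \<Longrightarrow> pos v < n \<and> \<sigma> ! pos v = v"
    and pos_ends: "\<And>v. v < n \<Longrightarrow> ends v \<Longrightarrow> pos v < length L" by metis
  \<comment> \<open>Colors are indexed by presentation time; \<open>pos\<close> turns them into a
    coloring of the nodes.\<close>
  define c where "c s v = A n (view_at (chain k m s) Suc \<sigma> (T n) (Suc (pos v)))" for s v
  have k0: "0 < k" using k by simp
  have "0 < n" using k0 m by (metis less_le_trans nat_0_less_mult_iff)
  then have "n \<le> n ^ C" using k(2) by (simp add: self_le_power)
  then have ident: "inj_on Suc {0..<n}" "Suc ` {0..<n} \<subseteq> {1..n ^ C}" by auto
  have col: "\<forall>j<n. A n (view_at (chain k m s) Suc \<sigma> (T n) (Suc j)) < 2 * k - 2"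
    "\<forall>j<n. \<forall>j'<n. chain k m s (\<sigma> ! j) (\<sigma> ! j') \<longrightarrow>
       A n (view_at (chain k m s) Suc \<sigma> (T n) (Suc j)) \<noteq> A n (view_at (chain k m s) Suc \<sigma> (T n) (Suc j'))"
    for s
    using A[unfolded solves_coloring_def, rule_format, of n "chain k m s" Suc \<sigma>]
      is_graph_chain[OF k0 m(2)] k_partite_chain[OF k0] ident \<sigma> by (simp_all add: Let_def)
  have bound: "c s v < 2 * k - 2" if "v < n" for s v
    using col(1) pos[OF that] by (simp add: c_def)
  have proper: "c s x \<noteq> c s y" if "chain k m s x y" for s x y
  proof -
    have "x < n" "y < n" using that is_graph_chain[OF k0 m(2)] by (auto simp: is_graph_def)
    then show ?thesis using col(2)[of s, rule_format, of "pos x" "pos y"] pos that by (simp add: c_def)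
  qed
  have same: "c (T n) v = c m v" if "v < n" "ends v" for v
  proof -
    have "set (take (Suc (pos v)) \<sigma>) \<subseteq> set L"
      using pos_ends[OF that] by (simp add: \<sigma>_def set_take_subset)
    then have "view_at (chain k m (T n)) Suc \<sigma> (T n) (Suc (pos v)) =
        view_at (chain k m m) Suc \<sigma> (T n) (Suc (pos v))"
      using T by (intro view_at_chain_twist) (auto simp: L_def ends_def)
    then show ?thesis by (simp add: c_def)
  qed
  have node: "c (T n) (node k g a b) = c m (node k g a b)"
    if "a < k" "b < k" "g = 0 \<or> g = m - 1" for g a b
  proof (rule same)
    have "gadget k (node k g a b) < m" using that m(1) by (auto simp: gadget_node)
    then show "node k g a b < n" using gadget_less_iff[OF k0] m(2) by (metis less_le_trans)
    show "ends (node k g a b)" using that by (auto simp: ends_def gadget_node)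
  qed
  have row_cong: "rainbow_row k F \<longleftrightarrow> rainbow_row k G"
    if "\<And>a b. a < k \<Longrightarrow> b < k \<Longrightarrow> F a b = G a b" for F G
    unfolding rainbow_row_def using that by (metis (no_types, lifting) inj_on_cong lessThan_iff)
  let ?S = "\<lambda>s. straighten k s (c s)"
  have q: "2 * k - 2 < 2 * k - 1" and m1: "m - 1 < m" using k m by auto
  have type: "rainbow_row k (?S s (m - 1)) \<longleftrightarrow> rainbow_row k (?S s 0)"
    "rainbow_col k (?S s (m - 1)) \<longleftrightarrow> \<not> rainbow_row k (?S s (m - 1))" for s
    by (rule rainbow_row_coloring[OF k0 m(2) bound proper q m1]; assumption)+
  have "rainbow_row k (?S (T n) 0) \<longleftrightarrow> rainbow_row k (?S m 0)"
    by (rule row_cong) (simp add: straighten_def node)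
  \<comment> \<open>The last gadget lies beyond the cut \<open>T n\<close>, so the same colors are
    read transposed there, whereas the first gadget is read alike in both chains.\<close>
  moreover have "rainbow_row k (?S (T n) (m - 1)) \<longleftrightarrow> rainbow_col k (?S m (m - 1))"
    using T by (intro row_cong) (auto simp: straighten_def node)
  ultimately show False using type[of "T n"] type[of m] by blast
qed

theorem theorem3:
  fixes k C :: nat and A :: "nat \<Rightarrow> view \<Rightarrow> nat" and T :: "nat \<Rightarrow> nat"
  assumes "k \<ge> 2" and "C \<ge> 1"
    and "solves_coloring C (k_partite k) (2 * k - 2) A T"
  shows "(\<lambda>n. real (T n)) \<in> \<Omega>(\<lambda>n. real n)"
proof -
  define K where "K = k * k"
  have K: "0 < K" using assms(1) by (simp add: K_def)
  have "n \<le> 6 * K * T n" if n: "K * 4 \<le> n" for n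
  proof -
    define m where "m = n div K"
    have "4 \<le> m" using n K by (simp add: m_def less_eq_div_iff_mult_less_eq mult.commute)
    moreover have "m * K \<le> n" by (simp add: m_def)
    ultimately have "m < 2 * T n + 3"
      using locality_lower_bound[OF assms, of m n] by (simp add: K_def mult.assoc)
    \<comment> \<open>Here \<open>4 \<le> m\<close> forces \<open>1 \<le> T n\<close>, so the factor
      6 absorbs the additive constant.\<close>
    with \<open>4 \<le> m\<close> have "Suc m \<le> 6 * T n" by simp
    then have "K * Suc m \<le> K * (6 * T n)" by (rule mult_le_mono2)
    moreover have "n < K * Suc m"
      unfolding m_def using K by (simp add: dividend_less_times_div)
    ultimately show ?thesis by (simp add: mult_ac)
  qed
  then have "real n \<le> 6 * real K * real (T n)" if "K * 4 \<le> n" for n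
    using that by (metis of_nat_le_iff of_nat_mult of_nat_numeral)
  then have "(\<lambda>n. real n) \<in> O(\<lambda>n. real (T n))"
    by (intro bigoI[of _ "6 * real K"]) (auto simp: eventually_at_top_linorder)
  then show ?thesis by (simp add: bigomega_iff_bigo)
qed

end
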